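(* Let $n\ge 2$ and let $H=(V,E)$ be an $n$-uniform hypergraph. For $v\in V$ let $d_v$ be the degree of $v$ (the number of edges containing $v$), and for $I\subseteq V$ let $d(I)=\sum_{v\in I} d_v$. Then there is an independent set $I\subseteq V$ such that \[ d(I)\ge \frac{n-1}{n}\sum_{v\in V,\ d_v>0} d_v^{\frac{n-2}{n-1}}. \]
   Context: A hypergraph $H=(V,E)$ consists of a finite vertex set $V$ and a family $E$ of subsets of $V$ (edges); it is $n$-uniform if every edge has exactly $n$ elements. A set $I\subseteq V$ is independent if it contains no edge of $H$. *)

theory Defs
  imports Complex_Main
begin

definition hypergraph :: "'a set \<Rightarrow> 'a set set \<Rightarrow> bool" where
  "hypergraph V E \<longleftrightarrow> finite V \<and> (\<forall>e\<in>E. e \<subseteq> V)"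

definition uniform_edges :: "nat \<Rightarrow> 'a set set \<Rightarrow> bool" where
  "uniform_edges n E \<longleftrightarrow> (\<forall>e\<in>E. card e = n)"

definition independent_set :: "'a set \<Rightarrow> 'a set set \<Rightarrow> 'a set \<Rightarrow> bool" where
  "independent_set V E I \<longleftrightarrow> I \<subseteq> V \<and> (\<forall>e\<in>E. \<not> e \<subseteq> I)"

definition hdegree :: "'a set set \<Rightarrow> 'a \<Rightarrow> nat" where
  "hdegree E v = card {e \<in> E. v \<in> e}"

definition hdegree_sum :: "'a set set \<Rightarrow> 'a set \<Rightarrow> nat" where
  "hdegree_sum E I = (\<Sum>v\<in>I. hdegree E v)"

end

theory Submission
  imports Defs
begin

text \<open>
  Choose every vertex \<open>v\<close> of positive degree independently with probability
  \<open>p v = d v powr (-1/(n-1))\<close>, and delete from each edge inside the chosen set a vertex of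
  minimum degree \<open>m e\<close>. The expected degree sum before the deletion is
  \<open>S = (\<Sum>v. d v powr ((n-2)/(n-1)))\<close>. For every \<open>u\<close> in an edge \<open>e\<close> the product of the \<open>n - 1\<close> numbers
  \<open>p v\<close>, \<open>v \<in> e - {u}\<close>, is at most \<open>1 / m e\<close>, so the expected loss \<open>m e * (\<Prod>v\<in>e. p v)\<close> at \<open>e\<close> is at
  most \<open>p u\<close>; averaging over \<open>u \<in> e\<close> and summing over \<open>e\<close> bounds the total loss by \<open>S / n\<close>.
  The expectation is a multilinear function of \<open>p\<close>, and in place of a probability space we use
  that such a function on a cube is dominated by its value at some corner.
\<close>

text \<open>By \<open>affine\<close>, \<open>F p\<close> is a convex combination of its values with
  one coordinate set to 0 and to 1, so rounding that coordinate to the better end does not decrease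
  \<open>F\<close>. The coordinates in \<open>A\<close> are rounded one at a time.\<close>

lemma multiaffine_corner_ge:
  fixes F :: "('a \<Rightarrow> real) \<Rightarrow> real"
  assumes "finite A"
    and affine: "\<And>p v. F p = (1 - p v) * F (p(v := 0)) + p v * F (p(v := 1))"
    and "\<And>v. v \<in> A \<Longrightarrow> 0 \<le> p v \<and> p v \<le> 1"
  shows "\<exists>q. (\<forall>v\<in>A. q v = 0 \<or> q v = 1) \<and> (\<forall>v. v \<notin> A \<longrightarrow> q v = p v) \<and> F p \<le> F q"
  using assms(1,3)
proof (induction A rule: finite_induct)
  case empty
  then show ?case by auto
next
  case (insert x A)
  then obtain q where q: "\<forall>v\<in>A. q v = 0 \<or> q v = 1" "\<forall>v. v \<notin> A \<longrightarrow> q v = p v" "F p \<le> F q"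
    by auto
  define t :: real where "t = (if F (q(x := 0)) \<le> F (q(x := 1)) then 1 else 0)"
  define M where "M = F (q(x := t))"
  have M: "F (q(x := 0)) \<le> M" "F (q(x := 1)) \<le> M"
    by (auto simp: M_def t_def)
  \<comment> \<open>The coordinate \<open>x\<close> has not been rounded yet, so
    \<open>q x = p x\<close>.\<close>
  have "0 \<le> q x" "q x \<le> 1"
    using insert q(2) by auto
  then have "F q \<le> (1 - q x) * M + q x * M"
    unfolding affine[of q x] using M by (intro add_mono mult_left_mono) auto
  then have "F p \<le> F (q(x := t))"
    using q(3) by (simp add: M_def algebra_simps)
  moreover have "t = 0 \<or> t = 1"
    by (simp add: t_def)
  ultimately show ?case
    using q(1,2) by (intro exI[of _ "q(x := t)"]) (auto simp del: fun_upd_apply simp: fun_upd_def)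
qed

lemma prod_affine_in_coordinate:
  fixes p :: "'a \<Rightarrow> real"
  assumes "finite e"
  shows "prod p e = (1 - p v) * prod (p(v := 0)) e + p v * prod (p(v := 1)) e"
proof (cases "v \<in> e")
  case True
  have "prod (p(v := t)) (e - {v}) = prod p (e - {v})" for t
    by (intro prod.cong) auto
  then show ?thesis
    using assms True by (simp add: prod.remove[of e v] del: fun_upd_apply) simp
next
  case False
  then have "prod (p(v := t)) e = prod p e" for t
    by (intro prod.cong) auto
  then show ?thesis
    by (simp add: algebra_simps)
qed

lemma sum_affine_in_coordinate:
  fixes p :: "'a \<Rightarrow> real"
  shows "(\<Sum>u\<in>V. d u * p u) =
    (1 - p v) * (\<Sum>u\<in>V. d u * (p(v := 0)) u) + p v * (\<Sum>u\<in>V. d u * (p(v := 1)) u)"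
  unfolding sum_distrib_left sum.distrib[symmetric]
  by (intro sum.cong) (auto simp: algebra_simps)

text \<open>Double counting of incidences: the weight of \<open>v\<close> is collected once for each
  edge through \<open>v\<close>.\<close>

lemma sum_edges_eq_sum_hdegree:
  fixes f :: "'a \<Rightarrow> real"
  assumes "finite V" "\<forall>e\<in>E. e \<subseteq> V" "finite E"
  shows "(\<Sum>e\<in>E. \<Sum>v\<in>e. f v) = (\<Sum>v\<in>V. real (hdegree E v) * f v)"
proof -
  have "(\<Sum>e\<in>E. \<Sum>v\<in>e. f v) = (\<Sum>e\<in>E. \<Sum>v\<in>V. if v \<in> e then f v else 0)"
  proof (rule sum.cong)
    fix e assume "e \<in> E"
    then have "V \<inter> {v. v \<in> e} = e"
      using assms by auto
    then show "(\<Sum>v\<in>e. f v) = (\<Sum>v\<in>V. if v \<in> e then f v else 0)"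
      using assms by (simp add: sum.If_cases)
  qed simp
  also have "\<dots> = (\<Sum>v\<in>V. \<Sum>e\<in>E. if v \<in> e then f v else 0)"
    by (rule sum.swap)
  also have "\<dots> = (\<Sum>v\<in>V. real (hdegree E v) * f v)"
    using assms by (simp add: sum.If_cases hdegree_def Int_def)
  finally show ?thesis .
qed

text \<open>Removing \<open>x e\<close> from every edge \<open>e\<close> inside \<open>I\<close>
  leaves no edge inside. Only an inequality holds for the cost, since several edges may share the
  same deleted vertex.\<close>

lemma independent_set_by_deletion:
  assumes "finite V" "finite E" "I \<subseteq> V"
    and x: "\<And>e. e \<in> E \<Longrightarrow> x e \<in> e"
  shows "\<exists>J. independent_set V E J \<and>
    hdegree_sum E I \<le> hdegree_sum E J + (\<Sum>e\<in>{e\<in>E. e \<subseteq> I}. hdegree E (x e))"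
proof (intro exI conjI)
  define B where "B = {e\<in>E. e \<subseteq> I}"
  have fin: "finite I" "finite B"
    using assms finite_subset by (auto simp: B_def)
  show "independent_set V E (I - x ` B)"
    using x \<open>I \<subseteq> V\<close> unfolding independent_set_def B_def by blast
  have "x ` B \<subseteq> I"
    using x by (auto simp: B_def)
  then have "hdegree_sum E I = hdegree_sum E (I - x ` B) + sum (hdegree E) (x ` B)"
    unfolding hdegree_sum_def using fin(1) by (rule sum.subset_diff)
  also have "sum (hdegree E) (x ` B) \<le> (\<Sum>e\<in>B. hdegree E (x e))"
    using sum_image_le[of B "hdegree E" x] fin(2) by (simp add: o_def)
  finally show "hdegree_sum E I \<le> hdegree_sum E (I - x ` B) +
      (\<Sum>e\<in>{e\<in>E. e \<subseteq> I}. hdegree E (x e))"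
    by (simp add: B_def)
qed

text \<open>Split off the factor of \<open>u\<close>. The exponent is negative, so each of the other
  \<open>n - 1\<close> factors is at most \<open>m powr (-1/(n-1))\<close>; together they are at
  most \<open>1 / m\<close>, which cancels \<open>m\<close>.\<close>

lemma weighted_prod_le_member:
  fixes d :: "'a \<Rightarrow> real"
  assumes "finite e" "card e = n" "n \<ge> 2" "u \<in> e" "m > 0"
    and le: "\<And>v. v \<in> e \<Longrightarrow> m \<le> d v"
  shows "m * (\<Prod>v\<in>e. d v powr (- 1 / (real n - 1))) \<le> d u powr (- 1 / (real n - 1))"
proof -
  let ?p = "\<lambda>v. d v powr (- 1 / (real n - 1))"
  have "(\<Prod>v\<in>e - {u}. ?p v) \<le> (\<Prod>v\<in>e - {u}. m powr (- 1 / (real n - 1)))"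
    using assms by (intro prod_mono conjI powr_mono2') auto
  also have "\<dots> = (m powr (- 1 / (real n - 1))) ^ (n - 1)"
    using assms by simp
  also have "\<dots> = m powr - 1"
    using assms by (simp add: powr_power of_nat_diff)
  finally have "m * (\<Prod>v\<in>e - {u}. ?p v) \<le> 1"
    using \<open>m > 0\<close> by (simp add: powr_minus field_simps)
  then have "?p u * (m * (\<Prod>v\<in>e - {u}. ?p v)) \<le> ?p u"
    by (intro mult_left_le) auto
  then show ?thesis
    using assms by (simp add: prod.remove[of e u] mult.left_commute)
qed

theorem theorem2:
  fixes n :: nat and V :: "'a set" and E :: "'a set set"
  assumes "n \<ge> 2"
    and "hypergraph V E"
    and "uniform_edges n E"
  shows "\<exists>I. independent_set V E I \<and>
    real (hdegree_sum E I) \<ge>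
      (real n - 1) / real n *
        (\<Sum>v\<in>{v \<in> V. hdegree E v > 0}. real (hdegree E v) powr ((real n - 2) / (real n - 1)))"
proof -
  have V: "finite V" "\<forall>e\<in>E. e \<subseteq> V"
    using assms(2) by (auto simp: hypergraph_def)
  then have "finite E"
    by (meson PowI finite_Pow_iff finite_subset subsetI)
  have e: "finite e" "card e = n" "e \<noteq> {}" if "e \<in> E" for e
    using that assms V by (auto simp: uniform_edges_def finite_subset)
  let ?d = "\<lambda>v. real (hdegree E v)"
  define p where "p v = ?d v powr (- 1 / (real n - 1))" for v
  define S where
    "S = (\<Sum>v\<in>{v \<in> V. hdegree E v > 0}. ?d v powr ((real n - 2) / (real n - 1)))"
  have "\<exists>x. x \<in> e \<and> (\<forall>v\<in>e. hdegree E x \<le> hdegree E v)" if "e \<in> E" for e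
    using ex_min_if_finite[of "hdegree E ` e"] e[OF that] by (force simp: not_less)
  then obtain x where x: "\<And>e. e \<in> E \<Longrightarrow> x e \<in> e"
    and x_min: "\<And>e v. e \<in> E \<Longrightarrow> v \<in> e \<Longrightarrow> hdegree E (x e) \<le> hdegree E v"
    by metis
  \<comment> \<open>At \<open>p\<close> this is the expected degree sum minus the expected deletion
    cost; at a corner it is the actual value for the set with indicator \<open>q\<close>.\<close>
  define F where "F q = (\<Sum>v\<in>V. ?d v * q v) - (\<Sum>e\<in>E. ?d (x e) * prod q e)"
    for q :: "'a \<Rightarrow> real"

  have loss: "?d (x e) * prod p e \<le> (\<Sum>v\<in>e. p v) / n" if "e \<in> E" for e
  proof -
    \<comment> \<open>The edge \<open>e\<close> itself passes through \<open>x e\<close>, so the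
      minimum degree on \<open>e\<close> is positive, as the weighted product bound
      requires.\<close>
    have "{f \<in> E. x e \<in> f} \<noteq> {}"
      using that x by auto
    then have "?d (x e) > 0"
      using \<open>finite E\<close> by (simp add: hdegree_def card_gt_0_iff)
    then have "?d (x e) * prod p e \<le> p u" if "u \<in> e" for u
      unfolding p_def using that e \<open>e \<in> E\<close> x_min assms(1)
      by (intro weighted_prod_le_member) auto
    then have "of_nat (card e) * (?d (x e) * prod p e) \<le> (\<Sum>v\<in>e. p v)"
      by (rule sum_bounded_below)
    then show ?thesis
      using e(2)[OF that] assms(1) by (simp add: field_simps)
  qed
  have S: "(\<Sum>v\<in>V. ?d v * p v) = S"
  proof -
    have "(\<Sum>v\<in>V. ?d v * p v) = (\<Sum>v\<in>{v \<in> V. hdegree E v > 0}. ?d v * p v)"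
      using V by (intro sum.mono_neutral_right) auto
    also have "\<dots> = S"
      unfolding S_def
    proof (rule sum.cong)
      fix v assume "v \<in> {v \<in> V. hdegree E v > 0}"
      then have "?d v * p v = ?d v powr (1 + - 1 / (real n - 1))"
        unfolding p_def powr_add by simp
      also have "1 + - 1 / (real n - 1) = (real n - 2) / (real n - 1)"
        using assms(1) by (simp add: field_simps)
      finally show "?d v * p v = ?d v powr ((real n - 2) / (real n - 1))" .
    qed simp
    finally show ?thesis .
  qed
  have "(\<Sum>e\<in>E. ?d (x e) * prod p e) \<le> (\<Sum>e\<in>E. (\<Sum>v\<in>e. p v) / n)"
    using loss by (rule sum_mono)
  also have "\<dots> = S / n"
    using sum_edges_eq_sum_hdegree[OF V \<open>finite E\<close>, of p] S
    by (simp flip: sum_divide_distrib)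
  \<comment> \<open>The gain is \<open>S\<close> and the loss at most \<open>S / n\<close>.\<close>
  finally have Fp: "(real n - 1) / n * S \<le> F p"
    unfolding F_def S using assms(1) by (simp add: field_simps)

  \<comment> \<open>A positive degree is at least 1 and the exponent is negative; for degree 0 the
    convention \<open>0 powr a = 0\<close> gives \<open>p v = 0\<close>.\<close>
  have "0 \<le> p v \<and> p v \<le> 1" for v
  proof (cases "hdegree E v = 0")
    case False
    then have "p v \<le> 1 powr (- 1 / (real n - 1))"
      unfolding p_def using assms(1) by (intro powr_mono2') auto
    then show ?thesis
      by (simp add: p_def)
  qed (simp add: p_def)
  moreover have "F q = (1 - q v) * F (q(v := 0)) + q v * F (q(v := 1))" for q v
  proof -
    have "(\<Sum>e\<in>E. ?d (x e) * prod q e) =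
      (1 - q v) * (\<Sum>e\<in>E. ?d (x e) * prod (q(v := 0)) e) +
      q v * (\<Sum>e\<in>E. ?d (x e) * prod (q(v := 1)) e)"
      unfolding sum_distrib_left sum.distrib[symmetric]
    proof (rule sum.cong)
      fix f assume "f \<in> E"
      show "?d (x f) * prod q f = (1 - q v) * (?d (x f) * prod (q(v := 0)) f) +
          q v * (?d (x f) * prod (q(v := 1)) f)"
        unfolding prod_affine_in_coordinate[OF e(1)[OF \<open>f \<in> E\<close>], of q v]
        by (simp only: algebra_simps)
    qed simp
    then show ?thesis
      unfolding F_def sum_affine_in_coordinate[of ?d q V v]
      by (simp only: right_diff_distrib)
  qed
  ultimately obtain q where q: "\<forall>v\<in>V. q v = 0 \<or> q v = 1" "F p \<le> F q"
    using multiaffine_corner_ge[OF V(1), of F p] by auto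

  define I where "I = {v\<in>V. q v = 1}"
  have "I \<subseteq> V"
    by (auto simp: I_def)
  have "(\<Sum>v\<in>V. ?d v * q v) = (\<Sum>v\<in>I. ?d v * q v)"
    using V q by (intro sum.mono_neutral_right) (auto simp: I_def)
  also have "\<dots> = hdegree_sum E I"
    by (simp add: hdegree_sum_def I_def)
  finally have 1: "(\<Sum>v\<in>V. ?d v * q v) = hdegree_sum E I" .
  \<comment> \<open>At a corner, \<open>prod q f\<close> is 1 if \<open>f\<close> lies inside
    \<open>I\<close> and 0 otherwise, so only edges inside \<open>I\<close> are charged.\<close>
  have "prod q f = 0" if f: "f \<in> E" "\<not> f \<subseteq> I" for f
  proof -
    obtain a where "a \<in> f" "a \<notin> I"
      using f(2) by blast
    then have "q a = 0"
      using f(1) V q(1) by (auto simp: I_def)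
    then show ?thesis
      using \<open>a \<in> f\<close> e(1)[OF f(1)] by auto
  qed
  then have "(\<Sum>e\<in>E. ?d (x e) * prod q e) = (\<Sum>e\<in>{e\<in>E. e \<subseteq> I}. ?d (x e) * prod q e)"
    using \<open>finite E\<close> by (intro sum.mono_neutral_right) auto
  also have "\<dots> = (\<Sum>e\<in>{e\<in>E. e \<subseteq> I}. ?d (x e))"
  proof (rule sum.cong)
    fix f assume "f \<in> {e\<in>E. e \<subseteq> I}"
    then have "prod q f = 1"
      by (intro prod.neutral) (auto simp: I_def)
    then show "?d (x f) * prod q f = ?d (x f)"
      by simp
  qed simp
  finally have Fq: "F q = hdegree_sum E I - (\<Sum>e\<in>{e\<in>E. e \<subseteq> I}. ?d (x e))"
    by (simp add: F_def 1)

  obtain J where J: "independent_set V E J"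
    "hdegree_sum E I \<le> hdegree_sum E J + (\<Sum>e\<in>{e\<in>E. e \<subseteq> I}. hdegree E (x e))"
    using independent_set_by_deletion[OF V(1) \<open>finite E\<close> \<open>I \<subseteq> V\<close>, of x] x by blast
  from J(2) have "real (hdegree_sum E I) \<le>
      hdegree_sum E J + (\<Sum>e\<in>{e\<in>E. e \<subseteq> I}. ?d (x e))"
    by (simp flip: of_nat_sum of_nat_add)
  then have "(real n - 1) / n * S \<le> hdegree_sum E J"
    using Fp Fq q(2) by linarith
  then show ?thesis
    using J(1) unfolding S_def by blast
qed

end
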